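(* Let $G$ be a finite group of order $pq^2$, where $p$ and $q$ are distinct primes and $p<q$. Then $|c(G)|$ is equal to one of $6$, $2q+4$, $q^2+3$, $q^2+q+2$, $2q+3$, or $3q+2$.
   Context: For a finite group $G$, $c(G)$ denotes the set of all cyclic subgroups of $G$ (including the trivial subgroup), so $|c(G)|$ is the number of cyclic subgroups of $G$. *)

theory Defs
  imports "HOL-Algebra.Algebra"
begin

definition cyclic_subgroups :: "('a, 'b) monoid_scheme \<Rightarrow> 'a set set" where
  "cyclic_subgroups G = {H. subgroup H G \<and> cyclic_group (G\<lparr>carrier := H\<rparr>)}"

end

(* Let c_d be the number of cyclic subgroups of order d, so that there are c_d * totient d elements
   of order d. Since p < q, the elements of q-power order form the unique Sylow q-subgroup; counting
   them and all elements gives c_q + q c_{q^2} = q + 1 and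
   c_p + (q - 1) c_{pq} + q (q - 1) c_{pq^2} = q^2.
   If c_{pq^2} > 0, these force all c_d = 1. Otherwise, counting conjugacy classes, either q divides
   c_p, so that (c_p, c_pq) is (q, q) or (q^2, 0), or there is a central element of order p; then
   (c_p, c_pq) = (1, q + 1), and c_{q^2} = 0 as otherwise there would be an element of order pq^2. *)
theory Submission
  imports Defs "HOL-Number_Theory.Totient"
begin

section \<open>Cyclic subgroups and their generators\<close>

definition cyclic_subgroups_of_order :: "('a, 'b) monoid_scheme \<Rightarrow> nat \<Rightarrow> 'a set set" where
  "cyclic_subgroups_of_order G d = {H \<in> cyclic_subgroups G. card H = d}"

context group
begin

text \<open>This turns the intrinsic notion, a restricted structure that is a cyclic group, into
  single generators, so that subgroups can be counted through elements.\<close>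

lemma cyclic_subgroups_eq_generate:
  "cyclic_subgroups G = (\<lambda>x. generate G {x}) ` carrier G"
proof (intro Set.set_eqI iffI)
  fix H assume "H \<in> cyclic_subgroups G"
  then have H: "subgroup H G" and "cyclic_group (G\<lparr>carrier := H\<rparr>)"
    by (auto simp: cyclic_subgroups_def)
  then obtain x where x: "x \<in> H" "H = range (\<lambda>n::int. x [^]\<^bsub>G\<lparr>carrier := H\<rparr>\<^esub> n)"
    using group.cyclic_group[OF subgroup_imp_group[OF H]] by auto
  then have "H = generate G {x}"
    using generate_pow[of x] subgroup.mem_carrier[OF H x(1)] int_pow_consistent[OF H x(1)]
    by auto
  then show "H \<in> (\<lambda>x. generate G {x}) ` carrier G"
    using subgroup.mem_carrier[OF H x(1)] by blast
next
  fix H assume "H \<in> (\<lambda>x. generate G {x}) ` carrier G"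
  then obtain x where x: "x \<in> carrier G" and H: "H = generate G {x}" by blast
  have sub: "subgroup H G" unfolding H using x by (intro generate_is_subgroup) auto
  have xH: "x \<in> H" unfolding H by (simp add: generate.incl)
  have "H = range (\<lambda>n::int. x [^]\<^bsub>G\<lparr>carrier := H\<rparr>\<^esub> n)"
    using generate_pow[OF x] int_pow_consistent[OF sub xH] H by (auto simp: full_SetCompr_eq)
  then have "cyclic_group (G\<lparr>carrier := H\<rparr>)"
    using group.cyclic_group[OF subgroup_imp_group[OF sub]] xH by auto
  then show "H \<in> cyclic_subgroups G"
    using sub by (simp add: cyclic_subgroups_def)
qed

text \<open>Coprime powers preserve the order, so the obvious inclusion is between finite sets of
  equal size.\<close>

lemma generate_pow_coprime:
  assumes "finite (carrier G)" "x \<in> carrier G" "coprime k (ord x)"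
  shows "generate G {x [^] k} = generate G {x}"
proof (rule card_subset_eq)
  have "generate G {x} \<subseteq> carrier G" using assms by (intro generate_incl) auto
  then show "finite (generate G {x})" using assms(1) finite_subset by blast
  show "generate G {x [^] k} \<subseteq> generate G {x}"
    using generate_pow_on_finite_carrier[OF assms(1)] assms(2)
    by (auto simp: nat_pow_pow)
  show "card (generate G {x [^] k}) = card (generate G {x})"
    using assms pow_ord_eq_ord_iff[OF assms(1,2), of k] generate_pow_card by simp
qed

text \<open>\<open>x\<close> is itself a power of \<open>x [^] k\<close>. Both membership criteria
  below end with this step.\<close>

lemma coprime_pow_mem_subgroup:
  assumes "finite (carrier G)" "x \<in> carrier G" "subgroup H G"
    and "coprime k (ord x)" "x [^] k \<in> H"
  shows "x \<in> H"
proof -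
  have "x \<in> generate G {x [^] k}"
    using generate_pow_coprime[OF assms(1,2,4)] by (simp add: generate.incl)
  then show ?thesis
    using generate_subgroup_incl[OF _ assms(3), of "{x [^] k}"] assms(5) by auto
qed

lemma card_generators:
  assumes fin: "finite (carrier G)" and a: "a \<in> carrier G"
  shows "card {x \<in> carrier G. generate G {x} = generate G {a}} = totient (ord a)"
proof -
  have "{x \<in> carrier G. generate G {x} = generate G {a}} = (\<lambda>k. a [^] k) ` totatives (ord a)"
  proof (intro Set.set_eqI iffI)
    fix x assume "x \<in> {x \<in> carrier G. generate G {x} = generate G {a}}"
    then have x: "x \<in> carrier G" "generate G {x} = generate G {a}" by auto
    then obtain k :: nat where k: "x = a [^] k"
      using generate_pow_on_finite_carrier[OF fin a] generate.incl[of x "{x}" G] by auto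
    have cop: "coprime k (ord a)"
      using pow_ord_eq_ord_iff[OF fin a, of k] x k generate_pow_card a by simp
    have pos: "ord a > 0" using ord_ge_1[OF fin a] by simp
    show "x \<in> (\<lambda>k. a [^] k) ` totatives (ord a)"
    proof (cases "ord a = 1")
      \<comment> \<open>\<open>totatives 1\<close> is \<open>{1}\<close>, while
        \<open>k mod 1\<close> is 0; the trivial element therefore cannot be handled by reducing the
        exponent.\<close>
      case True
      then have "1 \<in> totatives (ord a)" "a = \<one>" using ord_eq_1[OF a] by (auto simp: totatives_def)
      then show ?thesis using k by (force simp: image_iff)
    next
      case False
      let ?r = "k mod ord a"
      have "?r \<in> totatives (ord a)"
        using cop False pos
        by (auto simp: totatives_def intro!: Nat.gr0I)
      moreover have "a [^] k = a [^] (ord a * (k div ord a) + ?r)" by simp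
      then have "a [^] k = a [^] ?r"
        using a unfolding nat_pow_mult[OF a, symmetric] nat_pow_pow[OF a, symmetric] by simp
      ultimately show ?thesis using k by blast
    qed
  next
    fix x assume "x \<in> (\<lambda>k. a [^] k) ` totatives (ord a)"
    then show "x \<in> {x \<in> carrier G. generate G {x} = generate G {a}}"
      using generate_pow_coprime[OF fin a] a by (auto simp: totatives_def)
  qed
  moreover have "inj_on (\<lambda>k. a [^] k) (totatives (ord a))"
    by (rule inj_on_subset[OF ord_inj'[OF a]]) (auto simp: totatives_def)
  ultimately show ?thesis
    by (simp add: card_image totient_def)
qed

section \<open>Counting elements and cyclic subgroups by order\<close>

lemma finite_cyclic_subgroups: "finite (carrier G) \<Longrightarrow> finite (cyclic_subgroups G)"
  by (simp add: cyclic_subgroups_eq_generate)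

lemma cyclic_subgroups_of_order_nonempty:
  assumes "finite (carrier G)" "x \<in> carrier G"
  shows "card (cyclic_subgroups_of_order G (ord x)) > 0"
proof -
  have "generate G {x} \<in> cyclic_subgroups_of_order G (ord x)"
    using assms by (auto simp: cyclic_subgroups_of_order_def cyclic_subgroups_eq_generate
        generate_pow_card)
  moreover have "finite (cyclic_subgroups_of_order G (ord x))"
    using finite_cyclic_subgroups[OF assms(1)] by (simp add: cyclic_subgroups_of_order_def)
  ultimately show ?thesis by (auto simp: card_gt_0_iff)
qed

text \<open>Partition the elements of order \<open>d\<close> by the subgroup that they generate;
  each block is the set of generators of one cyclic group of order \<open>d\<close>.\<close>

lemma card_elements_of_order:
  assumes fin: "finite (carrier G)"
  shows "card {x \<in> carrier G. ord x = d} = card (cyclic_subgroups_of_order G d) * totient d"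
proof -
  let ?C = "cyclic_subgroups_of_order G d"
  let ?F = "\<lambda>H. {x \<in> carrier G. generate G {x} = H}"
  have "{x \<in> carrier G. ord x = d} = (\<Union>H\<in>?C. ?F H)"
    by (auto simp: cyclic_subgroups_of_order_def cyclic_subgroups_eq_generate generate_pow_card)
  moreover have "card (\<Union>H\<in>?C. ?F H) = (\<Sum>H\<in>?C. card (?F H))"
    using fin finite_cyclic_subgroups
    by (intro card_UN_disjoint) (auto simp: cyclic_subgroups_of_order_def)
  moreover have "card (?F H) = totient d" if "H \<in> ?C" for H
  proof -
    from that obtain a where "a \<in> carrier G" "H = generate G {a}" "card H = d"
      by (auto simp: cyclic_subgroups_of_order_def cyclic_subgroups_eq_generate)
    then show ?thesis using card_generators[OF fin, of a] generate_pow_card[of a] by simp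
  qed
  ultimately show ?thesis by simp
qed

lemma card_cyclic_subgroups_by_order:
  assumes fin: "finite (carrier G)"
  shows "card (cyclic_subgroups G) =
    (\<Sum>d | d dvd order G. card (cyclic_subgroups_of_order G d))"
proof -
  have "cyclic_subgroups G = (\<Union>d\<in>{d. d dvd order G}. cyclic_subgroups_of_order G d)"
    using ord_dvd_group_order
    by (auto simp: cyclic_subgroups_of_order_def cyclic_subgroups_eq_generate
        simp flip: generate_pow_card)
  moreover have "order G > 0" using fin by (simp add: order_gt_0_iff_finite)
  then have "card (\<Union>d\<in>{d. d dvd order G}. cyclic_subgroups_of_order G d)
      = (\<Sum>d | d dvd order G. card (cyclic_subgroups_of_order G d))"
    using fin finite_cyclic_subgroups
    by (intro card_UN_disjoint) (auto simp: cyclic_subgroups_of_order_def)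
  ultimately show ?thesis by simp
qed

lemma card_elements_dvd:
  assumes fin: "finite (carrier G)" and "n > 0"
  shows "card {x \<in> carrier G. ord x dvd n} =
    (\<Sum>d | d dvd n. card (cyclic_subgroups_of_order G d) * totient d)"
proof -
  have "{x \<in> carrier G. ord x dvd n} = (\<Union>d\<in>{d. d dvd n}. {x \<in> carrier G. ord x = d})" by auto
  also have "card \<dots> = (\<Sum>d | d dvd n. card {x \<in> carrier G. ord x = d})"
    using assms by (intro card_UN_disjoint) auto
  finally show ?thesis by (simp add: card_elements_of_order[OF fin])
qed

section \<open>Forcing elements into a subgroup\<close>

text \<open>Pigeonhole: with m the index of \<open>H\<close>, two of the m + 1 powers with exponents
  0, ..., m lie in the same coset, and their quotient lies in \<open>H\<close>. Normality is not
  assumed, and the price is that \<open>k\<close> is only bounded by the index.\<close>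

lemma exists_pow_mem_subgroup:
  assumes fin: "finite (carrier G)" and H: "subgroup H G" and x: "x \<in> carrier G"
  obtains k where "0 < k" "k \<le> card (rcosets H)" "x [^] k \<in> H"
proof -
  let ?f = "\<lambda>i::nat. H #> (x [^] i)"
  have Hc: "H \<subseteq> carrier G" using H by (rule subgroup.subset)
  have "?f ` {..card (rcosets H)} \<subseteq> rcosets H"
    using x by (auto intro!: rcosetsI[OF Hc])
  moreover have "finite (rcosets H)"
    using fin by (simp add: RCOSETS_def)
  ultimately have "card (?f ` {..card (rcosets H)}) \<le> card (rcosets H)"
    by (rule card_mono[rotated])
  then have "\<not> inj_on ?f {..card (rcosets H)}"
    using card_image[of ?f "{..card (rcosets H)}"] by auto
  then obtain i j where ij: "i < j" "j \<le> card (rcosets H)" "?f i = ?f j"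
    unfolding inj_on_def by (metis atMost_iff linorder_neqE_nat)
  have "x [^] j = x [^] (j - i) \<otimes> x [^] i"
    using ij x by (simp add: nat_pow_mult)
  moreover have "x [^] j \<in> H #> (x [^] i)"
    using ij x subgroup.one_closed[OF H] by (force simp: r_coset_def)
  then obtain h where "h \<in> H" "x [^] j = h \<otimes> x [^] i" by (auto simp: r_coset_def)
  ultimately have "x [^] (j - i) \<in> H"
    using x subgroup.mem_carrier[OF H] by (metis nat_pow_closed r_cancel)
  then show ?thesis using that[of "j - i"] ij by auto
qed

text \<open>In the quotient, raising to the power of its order gives the identity, so that power of
  \<open>x\<close> lies in \<open>N\<close>; coprimality then recovers \<open>x\<close>.\<close>

lemma normal_contains_coprime_order:
  assumes fin: "finite (carrier G)" and N: "N \<lhd> G" and x: "x \<in> carrier G"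
    and cop: "coprime (card (rcosets N)) (ord x)"
  shows "x \<in> N"
proof -
  interpret N: normal N G by (rule N)
  interpret Q: group "G Mod N" by (rule N.factorgroup_is_group)
  let ?m = "card (rcosets N)"
  have "N #> (x [^] ?m) = (N #> x) [^]\<^bsub>G Mod N\<^esub> ?m"
    using x by (simp add: N.FactGroup_pow)
  also have "\<dots> = N"
    using Q.pow_order_eq_1[of "N #> x"] x N.subset
    by (simp add: order_def FactGroup_def rcosetsI)
  finally have "x [^] ?m \<in> N"
    using x coset_join1[OF _ _ N.is_subgroup] N.subset by simp
  then show ?thesis
    using coprime_pow_mem_subgroup[OF fin x N.is_subgroup cop] by blast
qed

section \<open>Conjugacy classes and central elements\<close>

lemma ord_conjugate:
  assumes g: "g \<in> carrier G" and x: "x \<in> carrier G"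
  shows "ord (g \<otimes> x \<otimes> inv g) = ord x"
proof -
  have pow: "(g \<otimes> x \<otimes> inv g) [^] n = g \<otimes> x [^] n \<otimes> inv g" for n :: nat
  proof (induction n)
    case (Suc n)
    have "inv g \<otimes> (g \<otimes> z) = z" if "z \<in> carrier G" for z
      using g that by (simp flip: m_assoc)
    then show ?case using Suc g x by (simp add: m_assoc)
  qed (use g in simp)
  have "g \<otimes> y \<otimes> inv g = \<one> \<longleftrightarrow> y = \<one>" if "y \<in> carrier G" for y
    using conjugation_is_inj[OF g that one_closed] g by auto
  then show ?thesis
    using g x by (subst ord_unique) (auto simp: pow pow_eq_id)
qed

lemma ord_dvd_card_subgroup:
  assumes S: "subgroup S G" and x: "x \<in> S"
  shows "ord x dvd card S"
proof -
  have xG: "x \<in> carrier G" using subgroup.mem_carrier[OF S x] .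
  have "subgroup (generate G {x}) (G\<lparr>carrier := S\<rparr>)"
    using generate_is_subgroup[of "{x}"] xG S generate_subgroup_incl[OF _ S, of "{x}"] x
    by (intro subgroup_incl) auto
  from group.lagrange[OF subgroup_imp_group[OF S] this] show ?thesis
    using generate_pow_card[OF xG] by (simp add: order_def) (metis dvd_triv_right)
qed

text \<open>A class equation restricted to elements of order \<open>p\<close>, which form a union of
  conjugacy classes. The centralizer of such an element has order divisible by \<open>p\<close>, so
  its class has \<open>q\<close>-power size. Either some class is a singleton, which gives a central
  element, or \<open>q\<close> divides every class size.\<close>

lemma dvd_card_elements_of_order_or_central:
  assumes fin: "finite (carrier G)" and p: "p > 0" and q: "Factorial_Ring.prime q"
    and ord: "order G = p * q ^ n"
  shows "q dvd card {x \<in> carrier G. ord x = p} \<or>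
    (\<exists>x \<in> carrier G. ord x = p \<and> (\<forall>g \<in> carrier G. g \<otimes> x = x \<otimes> g))"
proof (rule disjCI)
  assume nc: "\<not> (\<exists>x \<in> carrier G. ord x = p \<and> (\<forall>g \<in> carrier G. g \<otimes> x = x \<otimes> g))"
  let ?\<phi> = "\<lambda>g. (\<lambda>h \<in> carrier G. g \<otimes> h \<otimes> (inv g))"
  interpret A: group_action G "carrier G" ?\<phi> by (rule action_by_conjugation)
  \<comment> \<open>Summing this indicator over the orbits counts the elements of order
    \<open>p\<close> class by class.\<close>
  let ?f = "\<lambda>x. if ord x = p then 1 else (0::nat)"
  have orb: "q dvd (\<Sum>x\<in>orb. ?f x)" if "orb \<in> orbits G (carrier G) ?\<phi>" for orb
  proof -
    from that obtain x where x: "x \<in> carrier G" and orb: "orb = orbit G ?\<phi> x"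
      by (auto simp: orbits_def)
    then have orb': "orb = {g \<otimes> x \<otimes> inv g | g. g \<in> carrier G}"
      by (auto simp: orbit_def)
    then have same: "ord y = ord x" if "y \<in> orb" for y
      using that x ord_conjugate by auto
    show ?thesis
    proof (cases "ord x = p")
      case False
      then show ?thesis using same by simp
    next
      case True
      \<comment> \<open>The stabilizer under conjugation is the centralizer, and \<open>x\<close>
        commutes with itself.\<close>
      have xs: "x \<in> stabilizer G ?\<phi> x"
        using x by (simp add: stabilizer_def m_assoc)
      have "p dvd card (stabilizer G ?\<phi> x)"
        using ord_dvd_card_subgroup[OF A.stabilizer_subgroup[OF x] xs] unfolding True .
      moreover have "card orb * card (stabilizer G ?\<phi> x) = p * q ^ n"
        using A.orbit_stabilizer_theorem[OF x] ord orb by simp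
      ultimately obtain j where "card orb * (p * j) = p * q ^ n" by (auto elim: dvdE)
      then have "q ^ n = card orb * j" using p by (auto simp: mult.left_commute)
      then have "card orb dvd q ^ n" by simp
      then obtain k where k: "card orb = q ^ k"
        using divides_primepow_nat[OF q] by blast
      have "k \<noteq> 0"
      proof
        assume "k = 0"
        then have "card orb = 1" using k by simp
        then obtain z where "orb = {z}" by (auto simp: card_1_singleton_iff)
        moreover have "x \<in> orb" using A.orbit_refl[OF x] orb by simp
        ultimately have "orb = {x}" by auto
        then have "g \<otimes> x \<otimes> inv g = x" if "g \<in> carrier G" for g
          using that orb' by blast
        then have "g \<otimes> x = x \<otimes> g" if "g \<in> carrier G" for g
          using that x inv_solve_right'[of x "g \<otimes> x" g] by auto
        with nc x True show False by blast
      qed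
      then show ?thesis using same True k by simp
    qed
  qed
  have "card {x \<in> carrier G. ord x = p} = (\<Sum>x\<in>carrier G. ?f x)"
    using fin by (simp add: sum.If_cases Int_def)
  also have "\<dots> = (\<Sum>orb\<in>orbits G (carrier G) ?\<phi>. \<Sum>x\<in>orb. ?f x)"
    by (rule A.disjoint_sum[OF fin, symmetric])
  also have "q dvd \<dots>" using orb by (rule dvd_sum)
  finally show "q dvd card {x \<in> carrier G. ord x = p}" .
qed

text \<open>The subgroup generated by a central element is normal. Its index \<open>m\<close> is
  coprime to \<open>p\<close>, so it contains every element of order \<open>p\<close>.\<close>

lemma card_cyclic_subgroups_of_order_central:
  assumes fin: "finite (carrier G)" and x: "x \<in> carrier G" "ord x = p"
    and central: "\<And>g. g \<in> carrier G \<Longrightarrow> g \<otimes> x = x \<otimes> g"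
    and ord: "order G = p * m" and cop: "coprime m p"
  shows "card (cyclic_subgroups_of_order G p) = 1"
proof -
  let ?N = "generate G {x}"
  have N: "subgroup ?N G" using x by (intro generate_is_subgroup) auto
  have "\<forall>h\<in>?N. g \<otimes> h \<otimes> inv g \<in> ?N" if g: "g \<in> carrier G" for g
  proof
    fix h assume h: "h \<in> ?N"
    then obtain k :: nat where k: "h = x [^] k"
      using generate_pow_on_finite_carrier[OF fin x(1)] by auto
    have "g \<otimes> x [^] k = x [^] k \<otimes> g"
      using group_commutes_pow[of x g k] central[OF g] g x by simp
    then have "g \<otimes> h \<otimes> inv g = h" using g x k by (simp add: m_assoc)
    then show "g \<otimes> h \<otimes> inv g \<in> ?N" using h by simp
  qed
  then have norm: "?N \<lhd> G" using N by (simp add: normal_inv_iff)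
  have "p > 0" using ord_ge_1[OF fin x(1)] x by simp
  then have "card (rcosets ?N) = m"
    using lagrange[OF N] ord generate_pow_card[OF x(1)] x(2) by simp
  then have mem: "y \<in> ?N" if "y \<in> carrier G" "ord y = p" for y
    using normal_contains_coprime_order[OF fin norm, of y] that cop by simp
  have "cyclic_subgroups_of_order G p = {?N}"
  proof (intro Set.set_eqI iffI)
    fix H assume "H \<in> cyclic_subgroups_of_order G p"
    then obtain y where y: "y \<in> carrier G" "H = generate G {y}" "ord y = p"
      by (auto simp: cyclic_subgroups_of_order_def cyclic_subgroups_eq_generate generate_pow_card)
    then have "H \<subseteq> ?N" using generate_subgroup_incl[OF _ N, of "{y}"] mem by auto
    moreover have "finite ?N" using fin N by (meson finite_subset subgroup.subset)
    moreover have "card H = card ?N" using x y by (metis generate_pow_card)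
    ultimately show "H \<in> {?N}" by (simp add: card_subset_eq)
  qed (use x in \<open>auto simp: cyclic_subgroups_of_order_def cyclic_subgroups_eq_generate
      simp flip: generate_pow_card\<close>)
  then show ?thesis by simp
qed

section \<open>The Sylow subgroup of small index, and products of commuting elements\<close>

text \<open>Let \<open>H\<close> be a Sylow subgroup. If \<open>x\<close> has \<open>q\<close>-power order, then by pigeonhole \<open>x [^] k \<in> H\<close> for some
  \<open>0 < k \<le> p < q\<close>; as \<open>k\<close> is coprime to \<open>ord x\<close>, already \<open>x \<in> H\<close>.\<close>

lemma card_sylow_elements_of_small_index:
  assumes fin: "finite (carrier G)" and q: "Factorial_Ring.prime q" and "p < q"
    and ord: "order G = p * q ^ n"
  shows "card {x \<in> carrier G. ord x dvd q ^ n} = q ^ n"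
proof -
  obtain H where H: "subgroup H G" "card H = q ^ n"
    using sylow_thm[OF q is_group _ fin, of n p] ord by (auto simp: mult.commute)
  have "q > 0" using q by (simp add: prime_gt_0_nat)
  then have "card (rcosets H) = p"
    using lagrange[OF H(1)] H(2) ord by simp
  then have "x \<in> H" if x: "x \<in> carrier G" "ord x dvd q ^ n" for x
  proof -
    obtain k where k: "0 < k" "k \<le> p" "x [^] k \<in> H"
      using exists_pow_mem_subgroup[OF fin H(1) x(1)] \<open>card (rcosets H) = p\<close> by metis
    have "\<not> q dvd k" using k \<open>p < q\<close> by (auto dest: dvd_imp_le)
    then have "coprime k (q ^ n)"
      using prime_imp_coprime[OF q] by (simp add: coprime_commute)
    then have "coprime k (ord x)" by (rule coprime_divisors[OF dvd_refl x(2)])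
    then show ?thesis using coprime_pow_mem_subgroup[OF fin x(1) H(1)] k(3) by blast
  qed
  then have "{x \<in> carrier G. ord x dvd q ^ n} = H"
    using ord_dvd_card_subgroup[OF H(1)] H subgroup.mem_carrier by fastforce
  then show ?thesis using H(2) by simp
qed

lemma ord_mult_commuting_coprime:
  assumes x: "x \<in> carrier G" and y: "y \<in> carrier G" and xy: "x \<otimes> y = y \<otimes> x"
    and cop: "coprime (ord x) (ord y)"
  shows "ord (x \<otimes> y) = ord x * ord y"
proof (rule dvd_antisym)
  \<comment> \<open>The exponent \<open>?n\<close> kills both the product and \<open>b\<close>,
    hence also \<open>a\<close>; coprimality then removes the factor \<open>ord b\<close>.
    Exchanging the two elements gives the other divisibility.\<close>
  have half: "ord a dvd ord (a \<otimes> b)"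
    if a: "a \<in> carrier G" "b \<in> carrier G" "a \<otimes> b = b \<otimes> a" and c: "coprime (ord a) (ord b)" for a b
  proof -
    let ?n = "ord (a \<otimes> b) * ord b"
    have "(a \<otimes> b) [^] ?n = \<one>" "b [^] ?n = \<one>"
      using a by (simp_all add: pow_eq_id)
    then have "a [^] ?n = \<one>"
      using pow_mult_distrib[OF a(3,1,2), of ?n] a by simp
    then have "ord a dvd ?n" using a by (simp add: pow_eq_id)
    then show ?thesis using c coprime_dvd_mult_left_iff by blast
  qed
  have "ord x dvd ord (x \<otimes> y)" "ord y dvd ord (x \<otimes> y)"
    using half[of x y] half[of y x] x y xy cop by (simp_all add: coprime_commute)
  then show "ord x * ord y dvd ord (x \<otimes> y)" using cop by (rule divides_mult)
qed (rule ord_mul_divides[OF xy x y])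

end

section \<open>Groups of order p q^2\<close>

lemma divisors_prime_mult_prime_square:
  fixes p q :: nat
  assumes "Factorial_Ring.prime p" "Factorial_Ring.prime q"
  shows "{d. d dvd q\<^sup>2} = {1, q, q\<^sup>2}"
    and "{d. d dvd p * q\<^sup>2} = {1, q, q\<^sup>2, p, p * q, p * q\<^sup>2}"
proof -
  have sq: "d dvd q\<^sup>2 \<longleftrightarrow> d \<in> {1, q, q\<^sup>2}" for d
  proof
    assume "d dvd q\<^sup>2"
    then obtain k where "k \<le> 2" "d = q ^ k"
      using divides_primepow_nat[OF assms(2)] by blast
    then show "d \<in> {1, q, q\<^sup>2}" by (auto simp: le_Suc_eq numeral_2_eq_2)
  qed auto
  then show "{d. d dvd q\<^sup>2} = {1, q, q\<^sup>2}" by blast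
  have "d dvd p * q\<^sup>2 \<longleftrightarrow> d \<in> {1, q, q\<^sup>2} \<or> d \<in> {p, p * q, p * q\<^sup>2}" for d
  proof
    assume "d dvd p * q\<^sup>2"
    then obtain a b where d: "d = a * b" "a dvd p" "b dvd q\<^sup>2"
      using division_decomp by blast
    from d(2) have "a = 1 \<or> a = p" using assms(1) by (simp add: prime_nat_iff)
    moreover from d(3) have "b = 1 \<or> b = q \<or> b = q\<^sup>2" using sq by simp
    ultimately show "d \<in> {1, q, q\<^sup>2} \<or> d \<in> {p, p * q, p * q\<^sup>2}"
      using d(1) by auto
  qed auto
  then show "{d. d dvd p * q\<^sup>2} = {1, q, q\<^sup>2, p, p * q, p * q\<^sup>2}" by blast
qed

theorem proposition3p2:
  fixes G :: "('a, 'b) monoid_scheme" and p q :: nat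
  assumes "group G" and "finite (carrier G)"
    and "Factorial_Ring.prime p" and "Factorial_Ring.prime q" and "p < q"
    and "order G = p * q ^ 2"
  shows "card (cyclic_subgroups G) \<in>
    {6, 2 * q + 4, q ^ 2 + 3, q ^ 2 + q + 2, 2 * q + 3, 3 * q + 2}"
proof -
  interpret group G by (rule assms(1))
  note fin = assms(2) and p = assms(3) and q = assms(4) and ordG = assms(6)
  have p2: "2 \<le> p" using p by (rule prime_ge_2_nat)
  then have q3: "3 \<le> q" using \<open>p < q\<close> by simp
  let ?c = "\<lambda>d. card (cyclic_subgroups_of_order G d)"
  define a b c e f where "a = ?c p" and "b = ?c (p * q)" and "c = ?c q" and "e = ?c (q\<^sup>2)"
    and "f = ?c (p * q\<^sup>2)"
  note defs = a_def b_def c_def e_def f_def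
  have cop: "coprime p q" using p q \<open>p < q\<close> by (simp add: primes_coprime)
  then have cop2: "coprime p (q\<^sup>2)" by simp
  have "p < q\<^sup>2" "q < p * q" "q < q\<^sup>2"
    using p2 q3 \<open>p < q\<close> by (auto simp: power2_eq_square intro: less_le_trans[of p q])
  moreover have "p * q < q\<^sup>2" using \<open>p < q\<close> q3 by (simp add: power2_eq_square)
  moreover have "q\<^sup>2 < p * q\<^sup>2" using p2 q3 by simp
  moreover have "q < p * q\<^sup>2"
    using \<open>q < q\<^sup>2\<close> \<open>q\<^sup>2 < p * q\<^sup>2\<close> by (rule less_trans)
  \<comment> \<open>Without collisions among the six divisors, the sums below split into one term
    per divisor.\<close>
  ultimately have distinct: "distinct [1, q, q\<^sup>2, p, p * q, p * q\<^sup>2]"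
    using p2 q3 \<open>p < q\<close> by auto
  have sum_G: "(\<Sum>d | d dvd order G. h d) = h 1 + h q + h (q\<^sup>2) + h p + h (p * q) + h (p * q\<^sup>2)"
    for h :: "nat \<Rightarrow> nat"
    unfolding ordG divisors_prime_mult_prime_square(2)[OF p q] using distinct by simp
  have sum_Q: "(\<Sum>d | d dvd q\<^sup>2. h d) = h 1 + h q + h (q\<^sup>2)" for h :: "nat \<Rightarrow> nat"
    unfolding divisors_prime_mult_prime_square(1)[OF p q] using distinct by simp
  have tot: "totient p = p - 1" "totient q = q - 1" "totient (q\<^sup>2) = q * (q - 1)"
    "totient (p * q) = (p - 1) * (q - 1)" "totient (p * q\<^sup>2) = (p - 1) * (q * (q - 1))"
    using p q cop by (simp_all add: totient_prime totient_prime_power totient_mult_coprime)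
  have c1: "?c 1 = 1"
  proof -
    have "{x \<in> carrier G. ord x = 1} = {\<one>\<^bsub>G\<^esub>}" using ord_eq_1 by auto
    then show ?thesis using card_elements_of_order[OF fin, of 1] by simp
  qed
  have Q: "1 + c * (q - 1) + e * (q * (q - 1)) = q\<^sup>2"
    using card_elements_dvd[OF fin, of "q\<^sup>2"] q3
      card_sylow_elements_of_small_index[OF fin q \<open>p < q\<close> ordG]
    unfolding sum_Q c1 tot defs by simp
  have pos: "order G > 0" using ordG p2 q3 by simp
  have "{x \<in> carrier G. ord x dvd order G} = carrier G" using ord_dvd_group_order by auto
  then have "p * q\<^sup>2 = 1 + c * (q - 1) + e * (q * (q - 1)) + a * (p - 1)
      + b * ((p - 1) * (q - 1)) + f * ((p - 1) * (q * (q - 1)))"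
    using card_elements_dvd[OF fin pos] ordG
    unfolding sum_G c1 tot defs by (simp add: order_def)
  \<comment> \<open>By \<open>Q\<close> the orders 1, q and q^2 account for q^2 elements; all
    remaining terms share the factor \<open>p - 1\<close>, which can be cancelled.\<close>
  then have "p * q\<^sup>2 = q\<^sup>2 + (p - 1) * (a + b * (q - 1) + f * (q * (q - 1)))"
    unfolding Q by (simp only: distrib_left add.assoc mult.assoc mult.commute mult.left_commute)
  moreover have "p * q\<^sup>2 = q\<^sup>2 + (p - 1) * q\<^sup>2"
    using p2 by (simp add: algebra_simps)
  ultimately have P: "a + b * (q - 1) + f * (q * (q - 1)) = q\<^sup>2"
    using p2 by simp
  \<comment> \<open>Replacing q - 1 by \<open>r\<close> avoids truncated subtraction and exposes the
    factor to cancel, as q^2 - 1 = r (q + 1).\<close>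
  obtain r where r: "q = Suc r" "2 \<le> r" using q3 by (cases q) auto
  have "r * (c + e * q) = r * (q + 1)" using Q r by (simp add: algebra_simps power2_eq_square)
  then have ce: "c + e * q = q + 1" unfolding mult_cancel1 using r(2) by linarith
  then have "e * q < 2 * q" using q3 by linarith
  then have "e \<le> 1" by simp
  with ce have ce_cases: "c = 1 \<and> e = 1 \<or> c = q + 1 \<and> e = 0" by (cases e) auto
  have total: "card (cyclic_subgroups G) = 1 + c + e + a + b + f"
    unfolding card_cyclic_subgroups_by_order[OF fin] sum_G c1 defs by simp
  have elem: "\<exists>x \<in> carrier G. ord x = d" if "?c d > 0" for d
    using that by (auto simp: card_gt_0_iff cyclic_subgroups_of_order_def
        cyclic_subgroups_eq_generate generate_pow_card)
  show ?thesis
  proof (cases "f = 0")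
    case False
    then obtain x where x: "x \<in> carrier G" "ord x = p * q\<^sup>2" using elem unfolding defs by auto
    \<comment> \<open>Powers of \<open>x\<close> realize every divisor of p q^2 as an order.\<close>
    have pw: "?c (p * q\<^sup>2 div k) > 0" if "k dvd p * q\<^sup>2" "k \<noteq> 0" for k
      using ord_pow[OF x(1), of k] that x cyclic_subgroups_of_order_nonempty[OF fin, of "x [^]\<^bsub>G\<^esub> k"]
      by simp
    have "a > 0" "b > 0" "e > 0"
      using pw[of "q\<^sup>2"] pw[of q] pw[of p] p2 q3 unfolding defs
      by (simp_all add: power2_eq_square flip: mult.assoc)
    \<comment> \<open>A positive \<open>f\<close> already uses q (q - 1) of the q^2 in
      \<open>P\<close>, leaving at most q for \<open>a\<close> and \<open>b\<close>. With both
      positive, b >= 2 would need at least 1 + 2 (q - 1) > q.\<close>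
    moreover have "q * (q - 1) \<le> f * (q * (q - 1))" using False by simp
    moreover have "q\<^sup>2 = q + q * (q - 1)" using r by (simp add: power2_eq_square)
    ultimately have ab: "a + b * (q - 1) \<le> q" using P by linarith
    have b1: "b = 1"
    proof (rule ccontr)
      assume "b \<noteq> 1"
      then have "2 * r \<le> b * r" using \<open>b > 0\<close> by (intro mult_right_mono) auto
      moreover have "a + b * r \<le> Suc r" using ab r(1) by simp
      ultimately show False using r(2) \<open>a > 0\<close> by linarith
    qed
    then have a1: "a = 1" using ab r \<open>a > 0\<close> by simp
    have "f * (q * r) = q * r" using P a1 b1 r by (simp add: power2_eq_square)
    then have "f = 1" using r by simp
    \<comment> \<open>All six counts are 1, so the total is 6.\<close>
    then show ?thesis using total a1 b1 ce_cases \<open>e > 0\<close> by auto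
  next
    case True
    then have P': "a + b * r = q * q" using P r by (simp add: power2_eq_square)
    have "q dvd a * (p - 1) \<or>
        (\<exists>x \<in> carrier G. ord x = p \<and> (\<forall>g \<in> carrier G. g \<otimes>\<^bsub>G\<^esub> x = x \<otimes>\<^bsub>G\<^esub> g))"
      using dvd_card_elements_of_order_or_central[OF fin _ q ordG] p2
      unfolding card_elements_of_order[OF fin] tot a_def by simp
    then show ?thesis
    proof
      assume "q dvd a * (p - 1)"
      moreover have "\<not> q dvd p - 1" using p2 \<open>p < q\<close> by (auto dest: dvd_imp_le)
      ultimately have qa: "q dvd a" using q by (simp add: prime_dvd_mult_iff)
      \<comment> \<open>Reducing \<open>P'\<close> modulo \<open>q\<close> passes the divisibility
        from \<open>a\<close> to \<open>b\<close>, because 0 < r < q.\<close>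
      have "q dvd a + b * r" using P' by simp
      then have "q dvd b * r" using qa by (simp add: dvd_add_right_iff)
      moreover have "\<not> q dvd r" using r by (auto dest: dvd_imp_le)
      ultimately have "q dvd b" using q by (simp add: prime_dvd_mult_iff)
      then obtain j where j: "b = q * j" by blast
      obtain k where k: "a = q * k" using qa by blast
      have "q * (k + j * r) = q * q" using P' j k by (simp add: algebra_simps)
      then have kj: "k + j * r = q" unfolding mult_cancel1 using r(1) by linarith
      \<comment> \<open>Here q = r + 1 < 2 r, since r >= 2.\<close>
      have "j * r < 2 * r" using kj r by linarith
      then have "j < 2" by simp
      then have "j = 0 \<and> k = q \<or> j = 1 \<and> k = 1" using kj r(1) by (auto simp: less_2_cases_iff)
      then have "a = q\<^sup>2 \<and> b = 0 \<or> a = q \<and> b = q" using j k by (auto simp: power2_eq_square)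
      \<comment> \<open>Two choices for \<open>(a, b)\<close> and two for \<open>(c, e)\<close> give
        the totals q^2 + 3, q^2 + q + 2, 2 q + 3 and 3 q + 2.\<close>
      then show ?thesis unfolding total True using ce_cases by (elim disjE conjE) simp_all
    next
      assume "\<exists>x \<in> carrier G. ord x = p \<and> (\<forall>g \<in> carrier G. g \<otimes>\<^bsub>G\<^esub> x = x \<otimes>\<^bsub>G\<^esub> g)"
      then obtain x where x: "x \<in> carrier G" "ord x = p"
        and central: "\<And>g. g \<in> carrier G \<Longrightarrow> g \<otimes>\<^bsub>G\<^esub> x = x \<otimes>\<^bsub>G\<^esub> g" by blast
      have a1: "a = 1"
        using card_cyclic_subgroups_of_order_central[OF fin x central ordG] cop2
        unfolding a_def by (simp add: coprime_commute)
      have "e = 0"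
      proof (rule ccontr)
        assume "e \<noteq> 0"
        then obtain y where y: "y \<in> carrier G" "ord y = q\<^sup>2" using elem unfolding defs by auto
        \<comment> \<open>The central \<open>x\<close> commutes with \<open>y\<close> and their
          orders are coprime, so the product would generate a cyclic subgroup counted by
          \<open>f\<close>.\<close>
        have "ord (x \<otimes>\<^bsub>G\<^esub> y) = p * q\<^sup>2"
          using ord_mult_commuting_coprime[OF x(1) y(1)] central[OF y(1)] x y cop2 by simp
        then have "f > 0"
          using cyclic_subgroups_of_order_nonempty[OF fin, of "x \<otimes>\<^bsub>G\<^esub> y"] x y unfolding defs by simp
        then show False using True by simp
      qed
      \<comment> \<open>With a = 1, \<open>P'\<close> reads b r = q^2 - 1. Since e = 0 forces c = q
        + 1, the total is 2 q + 4.\<close>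
      moreover have "b * r = (q + 1) * r" using P' a1 r by (simp add: algebra_simps)
      then have "b = q + 1" unfolding mult_cancel2 using r(2) by linarith
      ultimately show ?thesis using total a1 ce_cases True by auto
    qed
  qed
qed

end
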